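(* (1) $C(2^\omega,2^\omega)$ is embedded, as a topological monoid, into $(\mathbb N^{\mathbb N})^{op}$, and $(\mathbb N^{\mathbb N})^{op}$ is embedded, as a topological monoid, into $C(2^\omega,2^\omega)$. (2) $(\mathbb N^{\mathbb N})^{op}$ and $C(2^\omega,2^\omega)$ are not isomorphic as topological monoids.
   Context: $\mathbb N^{\mathbb N}$ is the topological monoid of all self-maps of the discrete set $\mathbb N$ under composition, with the pointwise (product) topology; $(\mathbb N^{\mathbb N})^{op}$ is its opposite monoid with the same topology. $2^\omega$ is the Cantor cube and $C(2^\omega,2^\omega)$ is the topological monoid of its continuous self-maps under composition with the compact-open topology. An embedding of topological monoids is an injective identity-preserving homomorphism which is a homeomorphism onto its image. *)

theory Defs
  imports "HOL-Analysis.Analysis" "HOL-Algebra.Group"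
begin

record 'a top_monoid = "'a monoid" +
  topo :: "'a topology"

definition topological_monoid :: "('a, 'm) top_monoid_scheme \<Rightarrow> bool" where
  "topological_monoid G \<longleftrightarrow>
     monoid G \<and> topspace (topo G) = carrier G \<and>
     continuous_map (prod_topology (topo G) (topo G)) (topo G) (\<lambda>(x, y). x \<otimes>\<^bsub>G\<^esub> y)"

definition opposite :: "('a, 'm) top_monoid_scheme \<Rightarrow> ('a, 'm) top_monoid_scheme" where
  "opposite G = G\<lparr>mult := \<lambda>x y. y \<otimes>\<^bsub>G\<^esub> x\<rparr>"

definition top_monoid_embedding ::
  "('a, 'm) top_monoid_scheme \<Rightarrow> ('b, 'n) top_monoid_scheme \<Rightarrow> ('a \<Rightarrow> 'b) \<Rightarrow> bool" where
  "top_monoid_embedding G H h \<longleftrightarrow>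
     h \<in> hom G H \<and> h \<one>\<^bsub>G\<^esub> = \<one>\<^bsub>H\<^esub> \<and> inj_on h (carrier G) \<and>
     embedding_map (topo G) (topo H) h"

definition top_monoid_isomorphism ::
  "('a, 'm) top_monoid_scheme \<Rightarrow> ('b, 'n) top_monoid_scheme \<Rightarrow> ('a \<Rightarrow> 'b) \<Rightarrow> bool" where
  "top_monoid_isomorphism G H h \<longleftrightarrow>
     h \<in> iso G H \<and> h \<one>\<^bsub>G\<^esub> = \<one>\<^bsub>H\<^esub> \<and> homeomorphic_map (topo G) (topo H) h"

(* The library's topology on a function type is the product topology, and nat and bool
   are discrete. So euclidean :: (nat => nat) topology is the topology of pointwise
   convergence (baire_topology below), and nat => bool is the Cantor cube
   (cantor_topology below). *)

lemma euclidean_discrete: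
  "(euclidean :: 'a::discrete_topology topology) = discrete_topology UNIV"
  by (simp add: topology_eq open_discrete)

lemma baire_topology:
  "(euclidean :: (nat \<Rightarrow> nat) topology) = product_topology (\<lambda>_. discrete_topology UNIV) UNIV"
  by (simp add: euclidean_product_topology flip: euclidean_discrete)

lemma cantor_topology:
  "(euclidean :: (nat \<Rightarrow> bool) topology) = product_topology (\<lambda>_. discrete_topology UNIV) UNIV"
  by (simp add: euclidean_product_topology flip: euclidean_discrete)

definition nat_self_maps :: "(nat \<Rightarrow> nat) top_monoid" where
  "nat_self_maps = \<lparr>carrier = UNIV, mult = (\<circ>), one = id, topo = euclidean\<rparr>"

type_synonym cantor = "nat \<Rightarrow> bool"

definition continuous_maps :: "('a::topological_space \<Rightarrow> 'b::topological_space) set" where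
  "continuous_maps = {f. continuous_on UNIV f}"

(* The underlying set is all of continuous_maps, as K = {} is allowed; see
   topspace_compact_open_topology. *)
definition compact_open_topology ::
  "('a::topological_space \<Rightarrow> 'b::topological_space) topology" where
  "compact_open_topology =
     topology_generated_by {{f \<in> continuous_maps. f ` K \<subseteq> U} | K U. compact K \<and> open U}"

definition continuous_self_maps :: "('a::topological_space \<Rightarrow> 'a) top_monoid" where
  "continuous_self_maps =
     \<lparr>carrier = continuous_maps, mult = (\<circ>), one = id, topo = compact_open_topology\<rparr>"

lemma continuous_maps_comp:
  "f \<circ> g \<in> continuous_maps" if "f \<in> continuous_maps" "g \<in> continuous_maps"
  using that unfolding continuous_maps_def mem_Collect_eq
  by (meson continuous_on_compose continuous_on_subset subset_UNIV)

lemma topspace_compact_open_topology: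
  "topspace (compact_open_topology :: ('a::topological_space \<Rightarrow> 'b::topological_space) topology)
     = continuous_maps"
proof -
  have "(continuous_maps :: ('a \<Rightarrow> 'b) set) \<in>
          {{f \<in> continuous_maps. f ` K \<subseteq> U} | K U. compact K \<and> open U}"
    by (rule CollectI, rule exI[of _ "{}"], rule exI[of _ UNIV]) auto
  then show ?thesis
    unfolding compact_open_topology_def topology_generated_by_topspace by blast
qed

lemma openin_compact_open:
  assumes "compact K" "open U"
  shows "openin compact_open_topology {f \<in> continuous_maps. f ` K \<subseteq> U}"
  unfolding compact_open_topology_def
  by (rule topology_generated_by_Basis) (use assms in blast)

lemma topological_monoid_opposite:
  assumes "topological_monoid G"
  shows "topological_monoid (opposite G)"
proof -
  interpret monoid G using assms by (simp add: topological_monoid_def)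
  have "monoid (opposite G)"
    by unfold_locales (auto simp: opposite_def m_assoc)
  moreover have "continuous_map (prod_topology (topo G) (topo G)) (topo G)
      ((\<lambda>(x, y). x \<otimes>\<^bsub>G\<^esub> y) \<circ> (\<lambda>(x, y). (y, x)))"
    using assms unfolding topological_monoid_def
    by (intro continuous_map_compose[where X'="prod_topology (topo G) (topo G)"])
      (auto simp: case_prod_unfold intro!: continuous_map_pairedI continuous_map_fst continuous_map_snd)
  ultimately show ?thesis
    using assms by (simp add: topological_monoid_def opposite_def comp_def case_prod_unfold)
qed

lemma topological_monoid_nat_self_maps: "topological_monoid nat_self_maps"
proof -
  have "continuous_on UNIV (\<lambda>p::(nat \<Rightarrow> nat) \<times> (nat \<Rightarrow> nat). (fst p \<circ> snd p) n)" for n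
    unfolding continuous_on_open_vimage[OF open_UNIV]
  proof (intro allI impI)
    fix B :: "nat set"
    have o: "open {f :: nat \<Rightarrow> nat. f k \<in> C}" for k C
    proof -
      have "continuous_on UNIV (\<lambda>f :: nat \<Rightarrow> nat. f k)"
        by simp
      from open_vimage[OF open_discrete this] show ?thesis
        by (simp add: vimage_def)
    qed
    have "(\<lambda>p::(nat \<Rightarrow> nat) \<times> (nat \<Rightarrow> nat). (fst p \<circ> snd p) n) -` B \<inter> UNIV
        = (\<Union>k. {f. f k \<in> B} \<times> {g. g n \<in> {k}})"
      by auto
    also have "open \<dots>"
      by (intro open_UN ballI open_Times o)
    finally show "open ((\<lambda>p::(nat \<Rightarrow> nat) \<times> (nat \<Rightarrow> nat). (fst p \<circ> snd p) n) -` B \<inter> UNIV)" .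
  qed
  then have "continuous_on UNIV (\<lambda>p::(nat \<Rightarrow> nat) \<times> (nat \<Rightarrow> nat). fst p \<circ> snd p)"
    by (rule continuous_on_coordinatewise_then_product)
  moreover have "monoid nat_self_maps"
    by unfold_locales (auto simp: nat_self_maps_def)
  ultimately show ?thesis
    by (simp add: topological_monoid_def nat_self_maps_def case_prod_unfold)
qed

lemma compact_UNIV_cantor: "compact (UNIV :: cantor set)"
proof -
  have "compact_space (discrete_topology (UNIV :: bool set))"
    by (simp add: compact_space_discrete_topology)
  then have "compact_space (euclidean :: cantor topology)"
    by (simp add: cantor_topology compact_space_product_topology)
  then show ?thesis
    by (simp add: compact_space_def)
qed

lemma Hausdorff_cantor: "Hausdorff_space (euclidean :: cantor topology)"
  by (simp add: cantor_topology Hausdorff_space_product_topology)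

lemma topological_monoid_continuous_self_maps:
  "topological_monoid (continuous_self_maps :: (cantor \<Rightarrow> cantor) top_monoid)"
proof -
  let ?T = "compact_open_topology :: (cantor \<Rightarrow> cantor) topology"
  have mon: "monoid (continuous_self_maps :: (cantor \<Rightarrow> cantor) top_monoid)"
    by unfold_locales
      (auto simp: continuous_self_maps_def continuous_maps_comp comp_assoc,
        simp add: continuous_maps_def)
  have "continuous_map (prod_topology ?T ?T) ?T (\<lambda>p. fst p \<circ> snd p)"
  proof (subst (3) compact_open_topology_def, rule continuous_on_generated_topo)
    fix W :: "(cantor \<Rightarrow> cantor) set"
    assume "W \<in> {{f \<in> continuous_maps. f ` K \<subseteq> U} | K U. compact K \<and> open U}"
    then obtain K U where W: "W = {f \<in> continuous_maps. f ` K \<subseteq> U}" and K: "compact K" and U: "open U"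
      by blast
    show "openin (prod_topology ?T ?T) ((\<lambda>p. fst p \<circ> snd p) -` W \<inter> topspace (prod_topology ?T ?T))"
    proof (subst openin_subopen, intro ballI)
      fix p
      assume "p \<in> (\<lambda>p. fst p \<circ> snd p) -` W \<inter> topspace (prod_topology ?T ?T)"
      then obtain f g where p: "p = (f, g)" and f: "continuous_on UNIV f" and g: "continuous_on UNIV g"
        and fg: "f ` (g ` K) \<subseteq> U"
        by (cases p) (auto simp: topspace_compact_open_topology continuous_maps_def W image_comp)
      have cg: "compact (g ` K)"
        using K g by (meson compact_continuous_image continuous_on_subset subset_UNIV)
      have oU: "open (f -` U)"
        using U f by (rule open_vimage)
      have "normal_space (euclidean :: cantor topology)"
        by (rule compact_Hausdorff_or_regular_imp_normal_space)
          (use compact_UNIV_cantor Hausdorff_cantor in \<open>auto simp: compact_space_def\<close>)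
      moreover have "closedin euclidean (g ` K)"
        using compactin_imp_closedin[OF Hausdorff_cantor] cg by (simp only: compactin_euclidean_iff)
      moreover have "openin euclidean (f -` U)"
        using oU by (simp only: open_openin)
      moreover have "g ` K \<subseteq> f -` U"
        using fg by (rule image_subset_iff_subset_vimage[THEN iffD1])
      ultimately have "\<exists>V. openin euclidean V \<and> g ` K \<subseteq> V \<and> euclidean closure_of V \<subseteq> f -` U"
        unfolding normal_space_alt by blast
      then obtain V where V: "open V" "g ` K \<subseteq> V" "closure V \<subseteq> f -` U"
        by (auto simp only: open_openin euclidean_closure_of)
      have cV: "compact (closure V)"
        using compact_Int_closed[OF compact_UNIV_cantor closed_closure] by simp
      let ?N = "{f \<in> continuous_maps. f ` closure V \<subseteq> U} \<times> {g \<in> continuous_maps. g ` K \<subseteq> V}"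
      have "openin (prod_topology ?T ?T) ?N"
        by (simp add: openin_prod_Times_iff openin_compact_open cV U K V(1))
      moreover have "p \<in> ?N"
        using V f g p by (auto simp: continuous_maps_def)
      moreover have "?N \<subseteq> (\<lambda>p. fst p \<circ> snd p) -` W \<inter> topspace (prod_topology ?T ?T)"
      proof clarify
        fix f' g' :: "cantor \<Rightarrow> cantor"
        assume a: "f' \<in> continuous_maps" "f' ` closure V \<subseteq> U" "g' \<in> continuous_maps" "g' ` K \<subseteq> V"
        then have "f' \<circ> g' \<in> continuous_maps"
          by (simp add: continuous_maps_comp)
        moreover have "(f' \<circ> g') ` K \<subseteq> U"
          using a closure_subset[of V] by fastforce
        ultimately show "(f', g') \<in> (\<lambda>p. fst p \<circ> snd p) -` W \<inter> topspace (prod_topology ?T ?T)"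
          using a by (simp add: W topspace_compact_open_topology)
      qed
      ultimately show "\<exists>N. openin (prod_topology ?T ?T) N \<and> p \<in> N \<and>
          N \<subseteq> (\<lambda>p. fst p \<circ> snd p) -` W \<inter> topspace (prod_topology ?T ?T)"
        by blast
    qed
  next
    have "fst p \<circ> snd p \<in> continuous_maps" if "p \<in> topspace (prod_topology ?T ?T)" for p
      using that by (auto simp: topspace_compact_open_topology continuous_maps_comp)
    then show "(\<lambda>p. fst p \<circ> snd p) ` topspace (prod_topology ?T ?T) \<subseteq>
        \<Union> {{f \<in> continuous_maps. f ` K \<subseteq> U} | K U. compact K \<and> open U}"
      using topspace_compact_open_topology[where ?'a=cantor and ?'b=cantor]
      unfolding compact_open_topology_def topology_generated_by_topspace by blast
  qed
  then show ?thesis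
    using mon by (simp add: topological_monoid_def continuous_self_maps_def
        topspace_compact_open_topology case_prod_unfold)
qed

end

(* A continuous self-map f of the Cantor cube is determined by the endomorphism b |-> f -` b of
   the Boolean algebra of clopen sets, a countably infinite set; this reverses composition and,
   by compactness, turns the compact-open topology into the topology of pointwise convergence.
   Conversely, a self-map g of the natural numbers acts on the Cantor cube by x |-> x o g.
   The opposite monoid has an element z with x z = z for all x (any constant map), whereas
   in the monoid of self-maps of the Cantor cube multiplying on the left by two different
   constant maps shows that there is no such element. *)

theory Submission
  imports Defs
begin

section \<open>Cylinders in sequence spaces over a discrete set\<close>

text \<open>Balls of the usual ultrametric, shrinking as \<open>n\<close> grows. The value type is
  left general so that they serve both for the Cantor cube and for the space of self-maps of the
  naturals.\<close>

definition cylinder :: "nat \<Rightarrow> (nat \<Rightarrow> 'b) \<Rightarrow> (nat \<Rightarrow> 'b) set" where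
  "cylinder n g = {g'. \<forall>i<n. g' i = g i}"

lemma open_coordinate:
  fixes C :: "'b::discrete_topology set"
  shows "open {g :: 'a \<Rightarrow> 'b. g i \<in> C}"
proof -
  have "continuous_on UNIV (\<lambda>g :: 'a \<Rightarrow> 'b. g i)"
    by simp
  from open_vimage[OF open_discrete this] show ?thesis
    by (simp add: vimage_def)
qed

lemma open_coordinates:
  fixes g :: "'a \<Rightarrow> 'b::discrete_topology"
  assumes "finite I"
  shows "open {g'. \<forall>i\<in>I. g' i = g i}"
proof -
  have "{g'. \<forall>i\<in>I. g' i = g i} = (\<Inter>i\<in>I. {g'. g' i \<in> {g i}})"
    by auto
  then show ?thesis
    using open_INT[OF assms, of "\<lambda>i. {g'. g' i \<in> {g i}}"] open_coordinate by metis
qed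

lemma open_cylinder: "open (cylinder n (g :: nat \<Rightarrow> 'b::discrete_topology))"
  using open_coordinates[of "{..<n}" g] by (simp add: cylinder_def Ball_def)

text \<open>A basic open box restricts only finitely many coordinates, and these have a common
  bound.\<close>

lemma open_contains_cylinder:
  fixes g :: "nat \<Rightarrow> 'b::discrete_topology"
  assumes "open W" "g \<in> W"
  obtains n where "cylinder n g \<subseteq> W"
proof -
  have "openin (product_topology (\<lambda>_. euclidean) UNIV) W"
    using assms(1) by (simp add: euclidean_product_topology)
  from product_topology_open_contains_basis[OF this assms(2)]
  obtain X where X: "g \<in> (\<Pi>\<^sub>E i\<in>UNIV. X i)" "finite {i. X i \<noteq> (UNIV :: 'b set)}"
    "(\<Pi>\<^sub>E i\<in>UNIV. X i) \<subseteq> W"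
    by auto
  obtain n where n: "\<And>i. X i \<noteq> UNIV \<Longrightarrow> i < n"
    using finite_nat_bounded[OF X(2)] by auto
  have "g' \<in> (\<Pi>\<^sub>E i\<in>UNIV. X i)" if "g' \<in> cylinder n g" for g'
  proof -
    have "g' i \<in> X i" for i
      using that X(1) n[of i] by (cases "X i = UNIV") (auto simp: cylinder_def PiE_iff)
    then show ?thesis
      by (simp add: PiE_iff)
  qed
  then show ?thesis
    using X(3) by (intro that[of n]) blast
qed

text \<open>A Lebesgue number for compact \<open>C\<close> inside open \<open>U\<close>: cover
  \<open>C\<close> by finitely many cylinders contained in \<open>U\<close> and take the largest of
  their lengths.\<close>

lemma compact_contains_cylinders:
  fixes C :: "(nat \<Rightarrow> 'b::discrete_topology) set"
  assumes "compact C" "open U" "C \<subseteq> U"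
  obtains n where "\<And>x. x \<in> C \<Longrightarrow> cylinder n x \<subseteq> U"
proof -
  have "\<forall>x\<in>C. \<exists>n. cylinder n x \<subseteq> U"
    using assms by (metis open_contains_cylinder subsetD)
  then obtain N where N: "\<And>x. x \<in> C \<Longrightarrow> cylinder (N x) x \<subseteq> U"
    by metis
  have "C \<subseteq> (\<Union>x\<in>C. cylinder (N x) x)"
    by (auto simp: cylinder_def)
  from compactE_image[OF assms(1) open_cylinder this] obtain D where D: "D \<subseteq> C" "finite D" "C \<subseteq> (\<Union>x\<in>D. cylinder (N x) x)"
    by blast
  obtain n where n: "\<And>x. x \<in> D \<Longrightarrow> N x \<le> n"
    using finite_nat_set_iff_bounded_le[of "N ` D"] D(2) by auto
  have "cylinder n x \<subseteq> U" if x: "x \<in> C" for x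
  proof -
    obtain d where d: "d \<in> D" "x \<in> cylinder (N d) d"
      using D(3) x by blast
    \<comment> \<open>As for ultrametric balls, any point of a cylinder is a centre of it, and
      \<open>N d \<le> n\<close>.\<close>
    have "cylinder n x \<subseteq> cylinder (N d) d"
      using d n[of d] by (auto simp: cylinder_def)
    then show ?thesis
      using N D(1) d(1) by blast
  qed
  then show ?thesis
    by (rule that)
qed

section \<open>Clopen subsets of the Cantor cube\<close>

definition clopens :: "'a::topological_space set set" where
  "clopens = {b. open b \<and> closed b}"

lemma clopens_coordinate: "{x :: cantor. x i} \<in> clopens"
  using open_coordinate[of i "{True}"] open_coordinate[of i "{False}"]
  by (simp add: clopens_def closed_def Collect_neg_eq)

lemma clopens_vimage:
  assumes "f \<in> continuous_maps" "b \<in> clopens"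
  shows "f -` b \<in> clopens"
  using assms by (auto simp: clopens_def continuous_maps_def intro: open_vimage closed_vimage)

lemma compact_clopen: "b \<in> clopens \<Longrightarrow> compact (b :: cantor set)"
  using compact_Int_closed[OF compact_UNIV_cantor, of b] by (simp add: clopens_def)

text \<open>By compactness, membership in a clopen set depends only on the first \<open>n\<close>
  bits for some \<open>n\<close>. So the set is coded by \<open>n\<close> and a finite list of
  prefixes, and such codes form a countable type.\<close>

lemma countable_clopens: "countable (clopens :: cantor set set)"
proof -
  let ?F = "\<lambda>(n, ls). {x :: cantor. map x [0..<n] \<in> set ls}"
  have "b \<in> range ?F" if b: "b \<in> clopens" for b
  proof -
    obtain n where n: "\<And>x. x \<in> b \<Longrightarrow> cylinder n x \<subseteq> b"
      using compact_contains_cylinders[OF compact_clopen[OF b]] b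
      by (auto simp: clopens_def)
    have "finite ((\<lambda>x :: cantor. map x [0..<n]) ` b)"
      by (rule finite_subset[OF _ finite_lists_length_eq[of "UNIV :: bool set" n]]) auto
    then obtain ls where ls: "set ls = (\<lambda>x. map x [0..<n]) ` b"
      using finite_list by blast
    have "x \<in> b" if "map x [0..<n] = map y [0..<n]" "y \<in> b" for x y
      using n[OF that(2)] that(1) by (auto simp: cylinder_def)
    then have "b = ?F (n, ls)"
      by (auto simp: ls)
    then show ?thesis
      by blast
  qed
  then have "clopens \<subseteq> range ?F"
    by (rule subsetI)
  then show ?thesis
    by (rule countable_subset) (rule countable_image[OF countableI_type])
qed

lemma infinite_clopens: "infinite (clopens :: cantor set set)"
proof -
  have "inj (\<lambda>i. {x :: cantor. x i})"
  proof (rule injI)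
    fix i j
    assume "{x :: cantor. x i} = {x. x j}"
    \<comment> \<open>The indicator of the singleton of \<open>i\<close> tells the coordinate sets
      apart.\<close>
    then have "(\<lambda>k. k = i) \<in> {x :: cantor. x j}"
      by blast
    then show "i = j"
      by simp
  qed
  then have "infinite (range (\<lambda>i. {x :: cantor. x i}))"
    by (rule range_inj_infinite)
  moreover have "range (\<lambda>i. {x :: cantor. x i}) \<subseteq> clopens"
    using clopens_coordinate by (rule image_subsetI)
  ultimately show ?thesis
    using infinite_super by metis
qed

section \<open>Neighbourhoods in the compact-open topology\<close>

text \<open>Equality of preimages splits into two subbasic conditions: \<open>?c\<close> is sent
  into \<open>b\<close> and its complement into the complement of \<open>b\<close>. Both sources are
  clopen, hence compact, and both targets are open.\<close>

lemma openin_compact_open_vimage: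
  fixes f :: "cantor \<Rightarrow> cantor"
  assumes "b \<in> clopens" "f \<in> continuous_maps"
  shows "openin compact_open_topology {g \<in> continuous_maps. g -` b = f -` b}"
proof -
  let ?c = "f -` b"
  have "- ?c \<in> clopens" "?c \<in> clopens"
    using clopens_vimage[OF assms(2,1)] by (auto simp: clopens_def)
  then have "openin compact_open_topology
      ({g \<in> continuous_maps. g ` ?c \<subseteq> b} \<inter> {g \<in> continuous_maps. g ` (- ?c) \<subseteq> - b})"
    using assms(1) by (intro openin_Int openin_compact_open compact_clopen) (auto simp: clopens_def)
  also have "{g \<in> continuous_maps. g ` ?c \<subseteq> b} \<inter> {g \<in> continuous_maps. g ` (- ?c) \<subseteq> - b}
      = {g \<in> continuous_maps. g -` b = ?c}"
    by blast
  finally show ?thesis .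
qed

lemma compact_open_contains_uniform:
  fixes f :: "'a::topological_space \<Rightarrow> (nat \<Rightarrow> 'b::discrete_topology)"
  assumes "openin compact_open_topology W" "f \<in> W"
  shows "\<exists>n. \<forall>g. g \<in> continuous_maps \<and> (\<forall>x. g x \<in> cylinder n (f x)) \<longrightarrow> g \<in> W"
proof -
  let ?P = "\<lambda>n g. g \<in> continuous_maps \<and> (\<forall>x. g x \<in> cylinder n (f x))"
  have mono: "?P m g" if "?P n g" "m \<le> n" for m n g
    using that by (auto simp: cylinder_def)
  have "generate_topology_on
      {{f \<in> continuous_maps. f ` K \<subseteq> U} | (K :: 'a set) (U :: (nat \<Rightarrow> 'b) set). compact K \<and> open U} W"
    using assms(1) unfolding compact_open_topology_def openin_topology_generated_by_iff .
  \<comment> \<open>Membership of \<open>f\<close> stays inside the induction claim, since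
    \<open>f\<close> may lie in only one member of a union.\<close>
  then have "f \<in> W \<longrightarrow> (\<exists>n. \<forall>g. ?P n g \<longrightarrow> g \<in> W)"
  proof induction
    case Empty
    then show ?case by simp
  next
    case (Int a b)
    show ?case
    proof
      assume "f \<in> a \<inter> b"
      then obtain m n where "\<forall>g. ?P m g \<longrightarrow> g \<in> a" "\<forall>g. ?P n g \<longrightarrow> g \<in> b"
        using Int by blast
      then have "\<forall>g. ?P (max m n) g \<longrightarrow> g \<in> a \<inter> b"
        using mono[where m=m and n="max m n"] mono[where m=n and n="max m n"] by simp
      then show "\<exists>n. \<forall>g. ?P n g \<longrightarrow> g \<in> a \<inter> b" ..
    qed
  next
    case (UN S)
    show ?case
    proof
      assume "f \<in> \<Union> S"
      then obtain s where s: "s \<in> S" "f \<in> s"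
        by blast
      then obtain n where "\<forall>g. ?P n g \<longrightarrow> g \<in> s"
        using UN by blast
      then have "\<forall>g. ?P n g \<longrightarrow> g \<in> \<Union> S"
        using s(1) by blast
      then show "\<exists>n. \<forall>g. ?P n g \<longrightarrow> g \<in> \<Union> S" ..
    qed
  next
    case (Basis s)
    then obtain K U where s: "s = {f \<in> continuous_maps. f ` K \<subseteq> U}" and K: "compact K" "open U"
      by blast
    show ?case
    proof
      assume "f \<in> s"
      then have "continuous_on UNIV f" "f ` K \<subseteq> U"
        by (auto simp: s continuous_maps_def)
      then obtain n where "\<And>y. y \<in> f ` K \<Longrightarrow> cylinder n y \<subseteq> U"
        using compact_contains_cylinders[of "f ` K" U] K
        by (metis compact_continuous_image continuous_on_subset subset_UNIV)
      then show "\<exists>n. \<forall>g. ?P n g \<longrightarrow> g \<in> s"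
        unfolding s by blast
    qed
  qed
  then show ?thesis
    using assms(2) by (rule mp)
qed

section \<open>A pointwise criterion for embeddings\<close>

lemma embedding_map_localI:
  assumes inj: "inj_on f (topspace X)" and f: "f ` topspace X \<subseteq> topspace Y"
    and cont: "\<And>x V. x \<in> topspace X \<Longrightarrow> openin Y V \<Longrightarrow> f x \<in> V \<Longrightarrow>
      \<exists>U. openin X U \<and> x \<in> U \<and> f ` U \<subseteq> V"
    and op: "\<And>x U. openin X U \<Longrightarrow> x \<in> U \<Longrightarrow>
      \<exists>V. openin Y V \<and> f x \<in> V \<and> (\<forall>x'\<in>topspace X. f x' \<in> V \<longrightarrow> x' \<in> U)"
  shows "embedding_map X Y f"
  unfolding embedding_map_def
proof (rule bijective_open_imp_homeomorphic_map)
  have "\<exists>U. openin X U \<and> x \<in> U \<and> (\<forall>y\<in>U. f y \<in> V)"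
    if "x \<in> topspace X" "openin Y V" "f x \<in> V" for x V
    using cont[OF that] by (simp only: image_subset_iff)
  then have "continuous_map X Y f"
    using f by (simp add: continuous_map_eq_topcontinuous_at topcontinuous_at_def
        image_subset_iff_funcset)
  then show "continuous_map X (subtopology Y (f ` topspace X)) f"
    by (simp add: continuous_map_in_subtopology)
  show "open_map X (subtopology Y (f ` topspace X)) f"
    unfolding open_map_def
  proof (intro allI impI)
    fix U assume U: "openin X U"
    show "openin (subtopology Y (f ` topspace X)) (f ` U)"
    proof (subst openin_subopen, intro ballI)
      fix y assume "y \<in> f ` U"
      then obtain x where x: "x \<in> U" "y = f x"
        by blast
      obtain V where V: "openin Y V" "f x \<in> V" "\<forall>x'\<in>topspace X. f x' \<in> V \<longrightarrow> x' \<in> U"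
        using op[OF U x(1)] by blast
      have "openin (subtopology Y (f ` topspace X)) (V \<inter> f ` topspace X)"
        using V(1) openin_subtopology by blast
      moreover have "y \<in> V \<inter> f ` topspace X"
        using V(2) x openin_subset[OF U] by blast
      moreover have "V \<inter> f ` topspace X \<subseteq> f ` U"
        using V(3) by blast
      ultimately show "\<exists>T. openin (subtopology Y (f ` topspace X)) T \<and> y \<in> T \<and> T \<subseteq> f ` U"
        by blast
    qed
  qed
  show "f ` topspace X = topspace (subtopology Y (f ` topspace X))"
    using f by auto
qed (fact inj)

section \<open>The two embeddings\<close>

lemma cantor_maps_embed_into_nat_self_maps_op:
  "\<exists>h. top_monoid_embedding
     (continuous_self_maps :: (cantor \<Rightarrow> cantor) top_monoid) (opposite nat_self_maps) h"
proof -
  let ?B = "clopens :: cantor set set"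
  obtain e where e: "bij_betw e ?B (UNIV :: nat set)"
    using to_nat_on_infinite[OF countable_clopens infinite_clopens] ..
  define d where "d = inv_into ?B e"
  have de: "d (e b) = b" if "b \<in> ?B" for b
    using e that by (simp add: d_def bij_betw_inv_into_left)
  have ed: "e (d i) = i" for i
    using e by (simp add: d_def bij_betw_inv_into_right)
  have dB: "d i \<in> ?B" for i
    using bij_betwE[OF bij_betw_inv_into[OF e]] by (simp add: d_def)
  have e_inj: "e b = e c \<longleftrightarrow> b = c" if "b \<in> ?B" "c \<in> ?B" for b c
    using that de by metis
  \<comment> \<open>The preimage endomorphism of the clopen algebra, transported to the naturals
    along the enumeration \<open>e\<close>.\<close>
  define h :: "(cantor \<Rightarrow> cantor) \<Rightarrow> nat \<Rightarrow> nat" where "h f i = e (f -` d i)" for f i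
  \<comment> \<open>\<open>c i\<close> is the index of the \<open>i\<close>-th coordinate set. The
    value of \<open>h f\<close> there encodes the \<open>i\<close>-th coordinate function of
    \<open>f\<close>, so these values determine \<open>f\<close>.\<close>
  define c where "c i = e {x :: cantor. x i}" for i
  have h_c: "h f (c i) = e {x. f x i}" for f i
    by (simp add: h_def c_def de clopens_coordinate vimage_def)
  have coord: "h f (c i) = h g (c i) \<longleftrightarrow> (\<forall>x. f x i = g x i)"
    if "f \<in> continuous_maps" "g \<in> continuous_maps" for f g i
  proof -
    have "{x. k x i} \<in> ?B" if "k \<in> continuous_maps" for k :: "cantor \<Rightarrow> cantor"
      using clopens_vimage[OF that clopens_coordinate[of i]] by (simp add: vimage_def)
    then have "h f (c i) = h g (c i) \<longleftrightarrow> {x. f x i} = {x. g x i}"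
      using that by (simp only: h_c e_inj)
    then show ?thesis
      by (simp add: set_eq_iff)
  qed
  have hom: "h (f \<circ> g) = h g \<circ> h f" if "f \<in> continuous_maps" for f g
    by (rule ext) (simp add: h_def de clopens_vimage[OF that dB] vimage_comp)
  have inj: "inj_on h continuous_maps"
  proof (intro inj_onI ext)
    fix f g x i
    assume "f \<in> continuous_maps" "g \<in> continuous_maps" "h f = h g"
    then show "f x i = g x i"
      using coord[of f g i] by simp
  qed
  have "embedding_map compact_open_topology euclidean h"
  proof (rule embedding_map_localI)
    fix f :: "cantor \<Rightarrow> cantor" and V
    assume "f \<in> topspace compact_open_topology" and V: "openin euclidean V" "h f \<in> V"
    then have f: "f \<in> continuous_maps"
      by (simp add: topspace_compact_open_topology)
    from V obtain n where n: "cylinder n (h f) \<subseteq> V"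
      using open_contains_cylinder by (metis open_openin)
    \<comment> \<open>Intersecting with the whole space covers \<open>n = 0\<close>, where the
      indexed intersection is \<open>UNIV\<close> and so contains discontinuous maps.\<close>
    let ?U = "(\<Inter>i\<in>{..<n}. {g \<in> continuous_maps. g -` d i = f -` d i}) \<inter> topspace compact_open_topology"
    have "openin compact_open_topology ?U"
      by (rule openin_INT) (auto intro: openin_compact_open_vimage dB f)
    moreover have "f \<in> ?U"
      using f by (simp add: topspace_compact_open_topology)
    moreover have "h ` ?U \<subseteq> V"
      using n by (auto simp: cylinder_def h_def)
    ultimately show "\<exists>U. openin compact_open_topology U \<and> f \<in> U \<and> h ` U \<subseteq> V"
      by blast
  next
    fix f :: "cantor \<Rightarrow> cantor" and U
    assume U: "openin compact_open_topology U" "f \<in> U"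
    then have f: "f \<in> continuous_maps"
      using openin_subset[OF U(1)] by (auto simp only: topspace_compact_open_topology)
    obtain n where n: "\<And>g. g \<in> continuous_maps \<and> (\<forall>x. g x \<in> cylinder n (f x)) \<Longrightarrow> g \<in> U"
      using compact_open_contains_uniform[OF U] by metis
    \<comment> \<open>By \<open>coord\<close>, agreement at the index \<open>c i\<close> means
      agreement of the \<open>i\<close>-th coordinates at every point. Finitely many values of
      \<open>h f\<close> thus control uniform closeness to \<open>f\<close>.\<close>
    let ?V = "{g. \<forall>j\<in>c ` {..<n}. g j = h f j}"
    have "open ?V"
      by (rule open_coordinates) simp
    moreover have "g \<in> U" if "g \<in> continuous_maps" "h g \<in> ?V" for g
      using that coord[OF that(1) f] by (intro n) (auto simp: cylinder_def)
    ultimately show "\<exists>V. openin euclidean V \<and> h f \<in> V \<and>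
        (\<forall>g\<in>topspace compact_open_topology. h g \<in> V \<longrightarrow> g \<in> U)"
      by (intro exI[of _ ?V]) (simp add: topspace_compact_open_topology)
  qed (use inj in \<open>simp_all add: topspace_compact_open_topology\<close>)
  moreover have "h id = id"
    by (rule ext) (simp add: h_def ed)
  ultimately have "top_monoid_embedding continuous_self_maps (opposite nat_self_maps) h"
    using inj hom
    by (auto simp: top_monoid_embedding_def continuous_self_maps_def opposite_def
        nat_self_maps_def hom_def)
  then show ?thesis
    by blast
qed

lemma nat_self_maps_op_embed_into_cantor_maps:
  "\<exists>h. top_monoid_embedding
     (opposite nat_self_maps) (continuous_self_maps :: (cantor \<Rightarrow> cantor) top_monoid) h"
proof -
  define h :: "(nat \<Rightarrow> nat) \<Rightarrow> cantor \<Rightarrow> cantor" where "h g x = x \<circ> g" for g x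
  have cont: "h g \<in> continuous_maps" for g
    unfolding continuous_maps_def h_def
    by (auto intro!: continuous_on_coordinatewise_then_product)
  have inj: "inj h"
  proof (intro injI ext)
    fix g g' :: "nat \<Rightarrow> nat" and i
    assume "h g = h g'"
    \<comment> \<open>Evaluated at the indicator of the singleton of \<open>g i\<close>, coordinate
      \<open>i\<close> of the image under \<open>h g'\<close> is true exactly when
      \<open>g' i = g i\<close>.\<close>
    then have "h g (\<lambda>k. k = g i) i = h g' (\<lambda>k. k = g i) i"
      by simp
    then show "g i = g' i"
      by (simp add: h_def)
  qed
  have "embedding_map euclidean compact_open_topology h"
  proof (rule embedding_map_localI)
    fix g V
    assume V: "openin compact_open_topology V" "h g \<in> V"
    obtain n where n: "\<And>f. f \<in> continuous_maps \<and> (\<forall>x. f x \<in> cylinder n (h g x)) \<Longrightarrow> f \<in> V"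
      using compact_open_contains_uniform[OF V] by metis
    \<comment> \<open>If \<open>g'\<close> agrees with \<open>g\<close> below \<open>n\<close>, then
      so does \<open>x \<circ> g'\<close> with \<open>x \<circ> g\<close>, for all \<open>x\<close>
      at once.\<close>
    have "h ` cylinder n g \<subseteq> V"
      by (auto intro!: n cont simp: cylinder_def h_def)
    moreover have "g \<in> cylinder n g"
      by (simp add: cylinder_def)
    ultimately show "\<exists>U. openin euclidean U \<and> g \<in> U \<and> h ` U \<subseteq> V"
      using open_cylinder by (metis open_openin)
  next
    fix g :: "nat \<Rightarrow> nat" and U
    assume "openin euclidean U" "g \<in> U"
    then obtain n where n: "cylinder n g \<subseteq> U"
      using open_contains_cylinder by (metis open_openin)
    \<comment> \<open>The same test points, as compact singletons: for \<open>h g'\<close>, the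
      \<open>i\<close>-th condition says \<open>g' i = g i\<close>.\<close>
    let ?V = "(\<Inter>i\<in>{..<n}. {f \<in> continuous_maps. f ` {\<lambda>k. k = g i} \<subseteq> {y :: cantor. y i \<in> {True}}})
      \<inter> topspace compact_open_topology"
    have "openin compact_open_topology ?V"
      by (intro openin_INT openin_compact_open open_coordinate) simp_all
    moreover have "h g \<in> ?V"
      using cont by (simp add: h_def topspace_compact_open_topology)
    moreover have "g' \<in> U" if "h g' \<in> ?V" for g'
      using that n by (auto simp: cylinder_def h_def)
    ultimately show "\<exists>V. openin compact_open_topology V \<and> h g \<in> V \<and>
        (\<forall>g'\<in>topspace euclidean. h g' \<in> V \<longrightarrow> g' \<in> U)"
      by (intro exI[of _ ?V] conjI ballI impI)
  qed (use inj cont in \<open>auto simp: topspace_compact_open_topology\<close>)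
  moreover have "h (g' \<circ> g) = h g \<circ> h g'" for g g'
    by (rule ext) (simp add: h_def comp_assoc)
  moreover have "h id = id"
    by (rule ext) (simp add: h_def)
  ultimately have "top_monoid_embedding (opposite nat_self_maps) continuous_self_maps h"
    using inj cont
    by (auto simp: top_monoid_embedding_def continuous_self_maps_def opposite_def
        nat_self_maps_def hom_def)
  then show ?thesis
    by blast
qed

section \<open>Non-isomorphism\<close>

lemma nat_self_maps_op_not_isomorphic_cantor_maps:
  "\<not> top_monoid_isomorphism
     (opposite nat_self_maps) (continuous_self_maps :: (cantor \<Rightarrow> cantor) top_monoid) h"
proof
  assume "top_monoid_isomorphism
     (opposite nat_self_maps) (continuous_self_maps :: (cantor \<Rightarrow> cantor) top_monoid) h"
  then have hom: "\<And>f g. h (g \<circ> f) = h f \<circ> h g" and surj: "h ` UNIV = continuous_maps"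
    by (auto simp: top_monoid_isomorphism_def iso_def hom_def bij_betw_def opposite_def
        nat_self_maps_def continuous_self_maps_def)
  define z where "z = h (\<lambda>_. 0)"
  \<comment> \<open>Precomposing a constant map with any \<open>f\<close> leaves it unchanged;
    \<open>h\<close> reverses the order of composition and reaches every continuous
    \<open>k\<close>.\<close>
  have absorb: "k \<circ> z = z" if k: "k \<in> continuous_maps" for k
  proof -
    obtain f where "k = h f"
      using k surj by blast
    then show ?thesis
      using hom[of "\<lambda>_. 0" f] by (simp add: z_def comp_def)
  qed
  \<comment> \<open>Absorption applied to the constant map with value \<open>c\<close>; as
    \<open>c\<close> is arbitrary, \<open>z x\<close> would equal every point.\<close>
  have "z x = c" for x c :: cantor
    using fun_cong[OF absorb[of "\<lambda>_. c"], of x] by (simp add: continuous_maps_def)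
  then have "(\<lambda>_. True) = (\<lambda>_ :: nat. False)"
    by metis
  then show False
    by (metis (full_types))
qed

theorem proposition5p11:
  shows "((\<exists>h. top_monoid_embedding
               (continuous_self_maps :: (cantor \<Rightarrow> cantor) top_monoid) (opposite nat_self_maps) h)
        \<and> (\<exists>h. top_monoid_embedding
               (opposite nat_self_maps) (continuous_self_maps :: (cantor \<Rightarrow> cantor) top_monoid) h))
      \<and> \<not> (\<exists>h. top_monoid_isomorphism
               (opposite nat_self_maps) (continuous_self_maps :: (cantor \<Rightarrow> cantor) top_monoid) h)"
  using cantor_maps_embed_into_nat_self_maps_op nat_self_maps_op_embed_into_cantor_maps
    nat_self_maps_op_not_isomorphic_cantor_maps
  by blast

end
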